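(* Let $X$ be a (real) Banach space with norm $|\cdot|$, ordered by a cone $K$, such that the norm is semi-monotone with respect to $K$. Let $N\colon X\to X$ be a (nonlinear) operator which is increasing: for $u,v\in K$, $0\le u\le v$ implies $N(u)\le N(v)$. Let $\|\cdot\|$ be a seminorm on $X$ which is increasing: for $u,v\in K$, $0\le u\le v$ implies $\|u\|\le\|v\|$. Let $\psi\in K\setminus\{0\}$ be such that $u\le|u|\,\psi$ for all $u\in K$. Assume: (i) there exists $\chi\in K\setminus\{0\}$ such that $N(u)\ge\|N(u)\|\chi$ for all $u\in K$; (ii) there exists $r>0$ such that $\|N(r\chi)\|\ge r$; (iii) there exists $R>0$ such that $|N(R\psi)|\le R$. Then $\underline{u}=r\chi$ and $\overline{u}=R\psi$ are a lower and an upper solution, respectively, of the equation $u=N(u)$, that is, $\underline{u}\le N(\underline{u})$ and $\overline{u}\ge N(\overline{u})$. Moreover, if $\underline{u}\le\overline{u}$ and the operator $N$ maps the interval $[\underline{u},\overline{u}]$ into a relatively compact set, then $N$ admits a fixed point in $[\underline{u},\overline{u}]$, i.e., there exists $u^\ast\in K$ such that $\underline{u}\le u^\ast\le\overline{u}$ and $N(u^\ast)=u^\ast$.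
   Context: A cone $K\subset X$ is a closed convex set with $tK\subset K$ for all $t\ge0$, $K\cap(-K)=\{0\}$ and $K\ne\{0\}$. The order is $u\le v$ iff $v-u\in K$, and $[\underline{u},\overline{u}]=\{u\in X:\underline{u}\le u\le\overline{u}\}$. The norm is semi-monotone if there is $\gamma>0$ such that $0\le u\le v$ implies $|u|\le\gamma|v|$. *)

theory Defs
  imports "HOL-Analysis.Analysis"
begin

text \<open>Nonemptiness is implied by \<open>K \<inter> uminus ` K = {0}\<close>; the library predicate
  \<^const>\<open>cone\<close> is closure under scaling by reals \<open>\<ge> 0\<close>.\<close>

definition order_cone :: "'a::real_normed_vector set \<Rightarrow> bool" where
  "order_cone K \<longleftrightarrow>
     closed K \<and> convex K \<and> cone K \<and> K \<inter> uminus ` K = {0} \<and> K \<noteq> {0}"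

definition cone_le :: "'a::real_vector set \<Rightarrow> 'a \<Rightarrow> 'a \<Rightarrow> bool" where
  "cone_le K u v \<longleftrightarrow> v - u \<in> K"

definition order_interval :: "'a::real_vector set \<Rightarrow> 'a \<Rightarrow> 'a \<Rightarrow> 'a set" where
  "order_interval K a b = {u. cone_le K a u \<and> cone_le K u b}"

definition semi_monotone_norm :: "'a::real_normed_vector set \<Rightarrow> bool" where
  "semi_monotone_norm K \<longleftrightarrow>
     (\<exists>\<gamma>>0. \<forall>u v. cone_le K 0 u \<and> cone_le K u v \<longrightarrow> norm u \<le> \<gamma> * norm v)"

definition seminorm :: "('a::real_vector \<Rightarrow> real) \<Rightarrow> bool" where
  "seminorm p \<longleftrightarrow>
     (\<forall>x. 0 \<le> p x) \<and> (\<forall>c x. p (c *\<^sub>R x) = \<bar>c\<bar> * p x) \<and> (\<forall>x y. p (x + y) \<le> p x + p y)"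

definition lower_solution :: "'a::real_vector set \<Rightarrow> ('a \<Rightarrow> 'a) \<Rightarrow> 'a \<Rightarrow> bool" where
  "lower_solution K N u \<longleftrightarrow> cone_le K u (N u)"

definition upper_solution :: "'a::real_vector set \<Rightarrow> ('a \<Rightarrow> 'a) \<Rightarrow> 'a \<Rightarrow> bool" where
  "upper_solution K N u \<longleftrightarrow> cone_le K (N u) u"

definition relatively_compact :: "'a::topological_space set \<Rightarrow> bool" where
  "relatively_compact S \<longleftrightarrow> compact (closure S)"

end

theory Submission
  imports Defs
begin

text \<open>
  The map \<open>N\<close> is not assumed continuous, so a Schauder type theorem does not apply, and
  iteration from the lower solution is not enough: the iterates converge, but their limit need not
  be fixed. The argument is order theoretic, and compactness serves only to produce suprema.

  A chain in a relatively compact set has a least upper bound in the closure of that set, because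
  the order is closed (\<open>chain_has_supremum_in_compact\<close>). Now take the set of all \<open>u\<close> in the interval
  with \<open>u \<le> N u\<close>, and a chain \<open>C\<close> in it. Although \<open>C\<close> itself need not have a supremum, its image
  \<open>N ` C\<close> has one, say \<open>s\<close>. It dominates \<open>C\<close>, as \<open>c \<le> N c \<le> s\<close>; monotonicity makes \<open>N s\<close> an upper
  bound of \<open>N ` C\<close>, so that \<open>s \<le> N s\<close>. By Zorn's lemma there is a maximal \<open>m\<close> with \<open>m \<le> N m\<close>.
  Then \<open>N m\<close> also satisfies \<open>N m \<le> N (N m)\<close>, and maximality forces \<open>N m = m\<close>
  (\<open>increasing_compact_fixpoint\<close>).

  That the end points are a lower and an upper solution is a direct computation: the seminorm
  hypotheses give \<open>N (r \<chi>) \<ge> \<parallel>N (r \<chi>)\<parallel> \<chi> \<ge> r \<chi>\<close>, and the norm hypotheses give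
  \<open>N (R \<psi>) \<le> |N (R \<psi>)| \<psi> \<le> R \<psi>\<close>.
\<close>

lemma order_cone_add:
  assumes "order_cone K" "x \<in> K" "y \<in> K"
  shows "x + y \<in> K"
  using assms convex_cone[of K] unfolding order_cone_def by blast

lemma order_cone_scaleR:
  assumes "order_cone K" "x \<in> K" "0 \<le> c"
  shows "c *\<^sub>R x \<in> K"
  using assms unfolding order_cone_def cone_def by blast

lemma cone_le_refl:
  assumes "order_cone K"
  shows "cone_le K x x"
  using assms unfolding order_cone_def cone_le_def by auto

lemma cone_le_trans:
  assumes "order_cone K" "cone_le K x y" "cone_le K y z"
  shows "cone_le K x z"
  using order_cone_add[of K "y - x" "z - y"] assms unfolding cone_le_def by simp

lemma cone_le_antisym:
  assumes "order_cone K" "cone_le K x y" "cone_le K y x"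
  shows "x = y"
proof -
  have "y - x \<in> K \<inter> uminus ` K"
    using assms(2,3) unfolding cone_le_def by (auto intro!: image_eqI[of _ _ "x - y"])
  then show ?thesis
    using assms(1) unfolding order_cone_def by auto
qed

lemma cone_le_scaleR_left:
  assumes "order_cone K" "x \<in> K" "a \<le> b"
  shows "cone_le K (a *\<^sub>R x) (b *\<^sub>R x)"
  using order_cone_scaleR[OF assms(1,2), of "b - a"] assms(3)
  unfolding cone_le_def by (simp add: scaleR_diff_left)

lemma cone_le_zero_iff: "cone_le K 0 x \<longleftrightarrow> x \<in> K"
  unfolding cone_le_def by simp

lemma closed_cone_le_above:
  assumes "order_cone K"
  shows "closed {x. cone_le K a x}"
proof -
  have "closed ((\<lambda>x. x - a) -` K)"
    using assms unfolding order_cone_def by (intro closed_vimage continuous_intros) auto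
  then show ?thesis
    by (simp add: vimage_def cone_le_def)
qed

lemma closed_cone_le_below:
  assumes "order_cone K"
  shows "closed {x. cone_le K x b}"
proof -
  have "closed ((\<lambda>x. b - x) -` K)"
    using assms unfolding order_cone_def by (intro closed_vimage continuous_intros) auto
  then show ?thesis
    by (simp add: vimage_def cone_le_def)
qed

lemma closed_order_interval:
  assumes "order_cone K"
  shows "closed (order_interval K a b)"
proof -
  have "order_interval K a b = {x. cone_le K a x} \<inter> {x. cone_le K x b}"
    unfolding order_interval_def by auto
  then show ?thesis
    using closed_cone_le_above[OF assms] closed_cone_le_below[OF assms] by (simp add: closed_Int)
qed

lemma finite_subset_of_chain_bounded:
  assumes K: "order_cone K"
    and chain: "\<And>x y. x \<in> D \<Longrightarrow> y \<in> D \<Longrightarrow> cone_le K x y \<or> cone_le K y x"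
    and "D \<noteq> {}" "finite F" "F \<subseteq> D"
  shows "\<exists>d\<in>D. \<forall>x\<in>F. cone_le K x d"
  using \<open>finite F\<close> \<open>F \<subseteq> D\<close>
proof (induction F rule: finite_induct)
  case empty
  then show ?case using \<open>D \<noteq> {}\<close> by auto
next
  case (insert x F)
  then obtain d where d: "d \<in> D" "\<forall>y\<in>F. cone_le K y d" by auto
  show ?case
  proof (cases "cone_le K x d")
    case True
    then show ?thesis using d by auto
  next
    case False
    then have "cone_le K d x" using chain insert.prems d(1) by blast
    then have "\<forall>y\<in>insert x F. cone_le K y x"
      using d(2) cone_le_trans[OF K] cone_le_refl[OF K] by blast
    then show ?thesis using insert.prems by auto
  qed
qed

text \<open>The supremum is a common point of the closures of the final segments of the chain. Finitely
  many of these segments always have an element of the chain in common, so compactness provides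
  such a point. It lies above every element and below every upper bound, because both conditions
  are closed.\<close>

lemma chain_has_supremum_in_compact:
  assumes K: "order_cone K"
    and chain: "\<And>x y. x \<in> D \<Longrightarrow> y \<in> D \<Longrightarrow> cone_le K x y \<or> cone_le K y x"
    and "D \<noteq> {}" "compact S" "D \<subseteq> S"
  shows "\<exists>s\<in>S. (\<forall>x\<in>D. cone_le K x s) \<and> (\<forall>b. (\<forall>x\<in>D. cone_le K x b) \<longrightarrow> cone_le K s b)"
proof -
  define T where "T d = closure {x \<in> D. cone_le K d x}" for d
  have "S \<inter> (\<Inter>d\<in>D. T d) \<noteq> {}"
  proof (rule compact_imp_fip_image[OF \<open>compact S\<close>])
    show "closed (T d)" for d by (simp add: T_def)
    fix F assume "finite F" "F \<subseteq> D"
    then obtain d where d: "d \<in> D" "\<forall>x\<in>F. cone_le K x d"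
      using finite_subset_of_chain_bounded[OF K chain \<open>D \<noteq> {}\<close>] by blast
    then have "d \<in> T x" if "x \<in> F" for x
      unfolding T_def using that by (intro subsetD[OF closure_subset]) auto
    then show "S \<inter> (\<Inter>x\<in>F. T x) \<noteq> {}"
      using d(1) \<open>D \<subseteq> S\<close> by auto
  qed
  then obtain s where s: "s \<in> S" "\<And>d. d \<in> D \<Longrightarrow> s \<in> T d" by auto
  have "cone_le K d s" if "d \<in> D" for d
  proof -
    have "T d \<subseteq> {x. cone_le K d x}"
      unfolding T_def by (rule closure_minimal) (auto simp: closed_cone_le_above[OF K])
    then show ?thesis using s(2)[OF that] by auto
  qed
  moreover have "cone_le K s b" if b: "\<forall>x\<in>D. cone_le K x b" for b
  proof -
    obtain d where "d \<in> D" using \<open>D \<noteq> {}\<close> by auto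
    moreover have "T d \<subseteq> {x. cone_le K x b}"
      unfolding T_def using b by (intro closure_minimal) (auto simp: closed_cone_le_below[OF K])
    ultimately show ?thesis using s(2) by auto
  qed
  ultimately show ?thesis using s(1) by blast
qed

text \<open>A fixed point theorem of Knaster--Tarski type, in which compactness of the image replaces
  completeness of the order.\<close>

lemma increasing_compact_fixpoint:
  assumes K: "order_cone K"
    and mono: "\<And>u v. u \<in> order_interval K a b \<Longrightarrow> v \<in> order_interval K a b \<Longrightarrow>
      cone_le K u v \<Longrightarrow> cone_le K (N u) (N v)"
    and "cone_le K a b" "cone_le K a (N a)" "cone_le K (N b) b"
    and compact: "relatively_compact (N ` order_interval K a b)"
  shows "\<exists>u\<in>order_interval K a b. N u = u"
proof -
  let ?I = "order_interval K a b"
  have a: "a \<in> ?I" and b: "b \<in> ?I"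
    using \<open>cone_le K a b\<close> cone_le_refl[OF K] by (auto simp: order_interval_def)
  have N_maps: "N u \<in> ?I" if "u \<in> ?I" for u
  proof -
    have "cone_le K (N a) (N u)" "cone_le K (N u) (N b)"
      using that mono a b by (auto simp: order_interval_def)
    then show ?thesis
      using cone_le_trans[OF K] assms(4,5) unfolding order_interval_def by blast
  qed
  define P where "P = {u \<in> ?I. cone_le K u (N u)}"
  have "\<exists>m\<in>P. \<forall>u\<in>P. cone_le K m u \<longrightarrow> u = m"
  proof (rule predicate_Zorn)
    show "partial_order_on P (relation_of (cone_le K) P)"
      using cone_le_refl[OF K] cone_le_trans[OF K] cone_le_antisym[OF K]
      by (intro partial_order_on_relation_ofI) blast+
  next
    fix C assume "C \<in> Chains (relation_of (cone_le K) P)"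
    then have C: "C \<subseteq> P"
      and chain: "\<And>x y. x \<in> C \<Longrightarrow> y \<in> C \<Longrightarrow> cone_le K x y \<or> cone_le K y x"
      by (auto simp: Chains_def relation_of_def)
    show "\<exists>u\<in>P. \<forall>c\<in>C. cone_le K c u"
    proof (cases "C = {}")
      case True
      then show ?thesis using a \<open>cone_le K a (N a)\<close> by (auto simp: P_def)
    next
      case False
      have CI: "C \<subseteq> ?I" using C by (auto simp: P_def)
      have "cone_le K x y \<or> cone_le K y x" if xy: "x \<in> N ` C" "y \<in> N ` C" for x y
      proof -
        obtain c d where "c \<in> C" "d \<in> C" "x = N c" "y = N d" using xy by auto
        then show ?thesis using chain[of c d] mono[of c d] mono[of d c] CI by auto
      qed
      moreover have "N ` C \<subseteq> closure (N ` ?I)"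
        using CI closure_subset[of "N ` ?I"] by blast
      ultimately have "\<exists>s\<in>closure (N ` ?I). (\<forall>x\<in>N ` C. cone_le K x s) \<and>
          (\<forall>z. (\<forall>x\<in>N ` C. cone_le K x z) \<longrightarrow> cone_le K s z)"
        using False compact unfolding relatively_compact_def
        by (intro chain_has_supremum_in_compact[OF K]) auto
      then obtain s where s: "s \<in> closure (N ` ?I)"
        and sup: "\<forall>x\<in>N ` C. cone_le K x s"
          "\<forall>z. (\<forall>x\<in>N ` C. cone_le K x z) \<longrightarrow> cone_le K s z"
        by (elim bexE conjE)
      have upper: "cone_le K (N c) s" if "c \<in> C" for c
        using sup(1) that by simp
      have "closure (N ` ?I) \<subseteq> ?I"
        using N_maps by (intro closure_minimal closed_order_interval[OF K]) auto
      then have sI: "s \<in> ?I" using s by blast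
      have dom: "cone_le K c s" if "c \<in> C" for c
        using cone_le_trans[OF K] upper[OF that] that C by (auto simp: P_def)
      have "cone_le K s (N s)"
        using mono sI dom CI by (intro sup(2)[rule_format]) auto
      then show ?thesis using sI dom by (auto simp: P_def)
    qed
  qed
  then obtain m where m: "m \<in> P" and max: "\<And>u. u \<in> P \<Longrightarrow> cone_le K m u \<Longrightarrow> u = m" by blast
  then have "N m \<in> P" using N_maps mono by (auto simp: P_def)
  then have "N m = m" using max m by (auto simp: P_def)
  then show ?thesis using m by (auto simp: P_def)
qed

theorem theorem7:
  fixes K :: "'a::banach set"
    and N :: "'a \<Rightarrow> 'a"
    and p :: "'a \<Rightarrow> real"
    and psi chi :: 'a
    and r R :: real
  assumes "order_cone K"
    and "semi_monotone_norm K"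
    and N_increasing: "\<And>u v. \<lbrakk>u \<in> K; v \<in> K; cone_le K 0 u; cone_le K u v\<rbrakk> \<Longrightarrow> cone_le K (N u) (N v)"
    and "seminorm p"
    and p_increasing: "\<And>u v. \<lbrakk>u \<in> K; v \<in> K; cone_le K 0 u; cone_le K u v\<rbrakk> \<Longrightarrow> p u \<le> p v"
    and "psi \<in> K - {0}"
    and psi_bound: "\<And>u. u \<in> K \<Longrightarrow> cone_le K u (norm u *\<^sub>R psi)"
    and "chi \<in> K - {0}"
    and i: "\<And>u. u \<in> K \<Longrightarrow> cone_le K (p (N u) *\<^sub>R chi) (N u)"
    and "r > 0"
    and ii: "p (N (r *\<^sub>R chi)) \<ge> r"
    and "R > 0"
    and iii: "norm (N (R *\<^sub>R psi)) \<le> R"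
  shows "lower_solution K N (r *\<^sub>R chi) \<and> upper_solution K N (R *\<^sub>R psi) \<and>
    (cone_le K (r *\<^sub>R chi) (R *\<^sub>R psi) \<and>
     relatively_compact (N ` order_interval K (r *\<^sub>R chi) (R *\<^sub>R psi))
     \<longrightarrow> (\<exists>u\<in>K. u \<in> order_interval K (r *\<^sub>R chi) (R *\<^sub>R psi) \<and> N u = u))"
proof -
  let ?a = "r *\<^sub>R chi" and ?b = "R *\<^sub>R psi"
  note K = \<open>order_cone K\<close>
  have aK: "?a \<in> K" and bK: "?b \<in> K"
    using order_cone_scaleR[OF K] \<open>chi \<in> K - {0}\<close> \<open>psi \<in> K - {0}\<close> \<open>r > 0\<close> \<open>R > 0\<close> by auto
  have lower: "cone_le K ?a (N ?a)"
    using cone_le_trans[OF K cone_le_scaleR_left[OF K _ ii] i[OF aK]] \<open>chi \<in> K - {0}\<close> by auto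
  \<comment> \<open>The bound by \<open>psi\<close> is available only in the cone, and hypothesis \<open>i\<close> places the values of \<open>N\<close>
    there.\<close>
  have "cone_le K (0 *\<^sub>R chi) (p (N ?b) *\<^sub>R chi)"
    using \<open>seminorm p\<close> \<open>chi \<in> K - {0}\<close>
    by (intro cone_le_scaleR_left[OF K]) (auto simp: seminorm_def)
  then have "N ?b \<in> K"
    using cone_le_trans[OF K _ i[OF bK]] by (simp flip: cone_le_zero_iff)
  then have upper: "cone_le K (N ?b) ?b"
    using cone_le_trans[OF K psi_bound cone_le_scaleR_left[OF K _ iii]] \<open>psi \<in> K - {0}\<close> by auto
  have sub: "u \<in> K" if "u \<in> order_interval K ?a ?b" for u
  proof -
    have "cone_le K 0 u"
      using cone_le_trans[OF K, of 0 ?a u] aK that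
      by (auto simp: order_interval_def cone_le_zero_iff)
    then show ?thesis by (simp add: cone_le_zero_iff)
  qed
  have "\<exists>u\<in>order_interval K ?a ?b. N u = u"
    if "cone_le K ?a ?b" "relatively_compact (N ` order_interval K ?a ?b)"
    using sub N_increasing
    by (intro increasing_compact_fixpoint[OF K _ that(1) lower upper that(2)])
      (auto simp: cone_le_zero_iff)
  then show ?thesis
    using lower upper sub unfolding lower_solution_def upper_solution_def by blast
qed

end
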